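(* Let $M$ be a loopless matroid on a finite set $E$ with rank function $r$, accessible through an oracle returning $r(T)$ for any $T \subseteq E$. Let $r'$ be defined by $r'(S) := \min \sum_{i=1}^k (2r(P_i)-1)$, the minimum over all partitions $\{P_1,\ldots,P_k\}$ of $S$. Then there is an algorithm that, on input $S \subseteq E$, computes $r'(S)$ using a number of rank evaluations in $M$ that is polynomial (in $|E|$).
   Context: A partition of a finite set $S$ is a set of pairwise disjoint nonempty subsets of $S$ whose union is $S$. By a separate result, $r'$ is the rank function of a matroid on $E$. *)

theory Defs
  imports
    "HOL-Library.Disjoint_Sets"
    "HOL-Library.Nat_Bijection"
    "HOL-Computational_Algebra.Polynomial"
begin

section \<open>Matroids\<close>

locale matroid =
  fixes E :: "'a set" and indep :: "'a set \<Rightarrow> bool"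
  assumes finite_ground: "finite E"
    and indep_subset_ground: "indep X \<Longrightarrow> X \<subseteq> E"
    and indep_empty: "indep {}"
    and indep_mono: "indep Y \<Longrightarrow> X \<subseteq> Y \<Longrightarrow> indep X"
    and indep_exchange:
      "indep X \<Longrightarrow> indep Y \<Longrightarrow> card X < card Y \<Longrightarrow> \<exists>y\<in>Y - X. indep (insert y X)"

locale loopless_matroid = matroid +
  assumes loopless: "e \<in> E \<Longrightarrow> indep {e}"

definition rank :: "('a set \<Rightarrow> bool) \<Rightarrow> 'a set \<Rightarrow> nat" where
  "rank indep S = Max (card ` {X. X \<subseteq> S \<and> indep X})"

text \<open>
  The summands are integers, so that the subtraction is not truncated. The blocks of
  \<^term>\<open>partition_on\<close> are nonempty, and the empty set has exactly one partition,
  the one without blocks.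
\<close>

definition partition_rank :: "('a set \<Rightarrow> bool) \<Rightarrow> 'a set \<Rightarrow> int" where
  "partition_rank indep S =
     Min ((\<lambda>P. \<Sum>X\<in>P. (2 * int (rank indep X) - 1)) ` {P. partition_on S P})"


section \<open>Algorithms with an oracle\<close>

text \<open>
  Algorithms are Kleene's partial recursive functions relative to an oracle
  \<open>orc\<close> on the natural numbers: the schemes of the partial recursive functions,
  together with the basic function \<open>Ask\<close> that calls the oracle. An algorithm is a
  finite syntactic object that has no access to \<open>orc\<close> except through \<open>Ask\<close>.

  \<open>eval orc f xs v q\<close> means: on the argument list \<open>xs\<close>, the evaluation of \<open>f\<close>
  terminates with value \<open>v\<close> and performs exactly \<open>q\<close> oracle calls, where repeated
  calls with the same argument are counted each time.
\<close>

datatype alg =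
    Zero
  | Succ
  | Proj nat
  | Ask
  | Comp alg "alg list"
  | PRec alg alg
  | Mu alg

inductive
  eval :: "(nat \<Rightarrow> nat) \<Rightarrow> alg \<Rightarrow> nat list \<Rightarrow> nat \<Rightarrow> nat \<Rightarrow> bool" and
  evals :: "(nat \<Rightarrow> nat) \<Rightarrow> alg list \<Rightarrow> nat list \<Rightarrow> nat list \<Rightarrow> nat \<Rightarrow> bool" and
  search :: "(nat \<Rightarrow> nat) \<Rightarrow> alg \<Rightarrow> nat \<Rightarrow> nat list \<Rightarrow> nat \<Rightarrow> nat \<Rightarrow> bool"
  for orc :: "nat \<Rightarrow> nat"
where
  Zero: "eval orc Zero xs 0 0"
| Succ: "eval orc Succ [x] (Suc x) 0"
| Proj: "i < length xs \<Longrightarrow> eval orc (Proj i) xs (xs ! i) 0"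
| Ask: "eval orc Ask [x] (orc x) 1"
| Comp: "evals orc gs xs ys q1 \<Longrightarrow> eval orc f ys v q2 \<Longrightarrow> eval orc (Comp f gs) xs v (q1 + q2)"
| PRec_0: "eval orc f xs v q \<Longrightarrow> eval orc (PRec f g) (0 # xs) v q"
| PRec_Suc:
    "eval orc (PRec f g) (n # xs) u q1 \<Longrightarrow> eval orc g (n # u # xs) v q2 \<Longrightarrow>
     eval orc (PRec f g) (Suc n # xs) v (q1 + q2)"
| Mu: "search orc f 0 xs v q \<Longrightarrow> eval orc (Mu f) xs v q"
| Nil: "evals orc [] xs [] 0"
| Cons:
    "eval orc g xs y q1 \<Longrightarrow> evals orc gs xs ys q2 \<Longrightarrow> evals orc (g # gs) xs (y # ys) (q1 + q2)"
| found: "eval orc f (k # xs) 0 q \<Longrightarrow> search orc f k xs k q"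
| next_candidate:
    "eval orc f (k # xs) (Suc y) q1 \<Longrightarrow> search orc f (Suc k) xs v q2 \<Longrightarrow>
     search orc f k xs v (q1 + q2)"

inductive_cases Zero_E: "eval orc Zero xs v q"
inductive_cases Succ_E: "eval orc Succ xs v q"
inductive_cases Proj_E: "eval orc (Proj i) xs v q"
inductive_cases Ask_E: "eval orc Ask xs v q"
inductive_cases Comp_E: "eval orc (Comp f gs) xs v q"
inductive_cases PRec_0_E: "eval orc (PRec f g) (0 # xs) v q"
inductive_cases PRec_Suc_E: "eval orc (PRec f g) (Suc n # xs) v q"
inductive_cases Mu_E: "eval orc (Mu f) xs v q"
inductive_cases Nil_E: "evals orc [] xs ys q"
inductive_cases Cons_E: "evals orc (g # gs) xs ys q"
inductive_cases search_E: "search orc f k xs v q"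

text \<open>Value and number of calls are determined by the oracle, the algorithm and the input.\<close>

lemma eval_deterministic:
  "eval orc f xs v q \<Longrightarrow> eval orc f xs v' q' \<Longrightarrow> v = v' \<and> q = q'"
  "evals orc gs xs ys q \<Longrightarrow> evals orc gs xs ys' q' \<Longrightarrow> ys = ys' \<and> q = q'"
  "search orc f k xs v q \<Longrightarrow> search orc f k xs v' q' \<Longrightarrow> v = v' \<and> q = q'"
proof (induction arbitrary: v' q' and ys' q' and v' q' rule: eval_evals_search.inducts)
  case (Zero xs)
  from Zero.prems show ?case by (rule Zero_E) simp_all
next
  case (Succ x)
  from Succ.prems show ?case by (rule Succ_E) simp_all
next
  case (Proj i xs)
  from Proj.prems show ?case by (rule Proj_E) simp_all
next
  case (Ask x)
  from Ask.prems show ?case by (rule Ask_E) simp_all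
next
  case (Comp gs xs ys q1 f v q2)
  from Comp.prems show ?case by (rule Comp_E) (use Comp.IH in blast)+
next
  case (PRec_0 f xs v q g)
  from PRec_0.prems show ?case by (rule PRec_0_E) (use PRec_0.IH in blast)+
next
  case (PRec_Suc f g n xs u q1 v q2)
  from PRec_Suc.prems show ?case by (rule PRec_Suc_E) (use PRec_Suc.IH in blast)+
next
  case (Mu f xs v q)
  from Mu.prems show ?case by (rule Mu_E) (use Mu.IH in blast)+
next
  case (Nil xs)
  from Nil.prems show ?case by (rule Nil_E) simp_all
next
  case (Cons g xs y q1 gs ys q2)
  from Cons.prems show ?case by (rule Cons_E) (use Cons.IH in blast)+
next
  case (found f k xs q)
  from found.prems show ?case by (rule search_E) (use found.IH in blast)+
next
  case (next_candidate f k xs y q1 v q2)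
  from next_candidate.prems show ?case by (rule search_E) (use next_candidate.IH in blast)+
qed


section \<open>The rank oracle\<close>

text \<open>
  For a numbering \<open>idx\<close> of the ground set by \<open>0, ..., card E - 1\<close>, a subset of \<open>E\<close> is
  presented to algorithms as the natural number whose binary digits are its indicator
  function. Digits of a query that belong to no element of \<open>E\<close> are ignored, so every query
  is the rank of some subset of \<open>E\<close>, and every subset of \<open>E\<close> can be queried.
\<close>

definition encode_subset :: "('a \<Rightarrow> nat) \<Rightarrow> 'a set \<Rightarrow> nat" where
  "encode_subset idx S = set_encode (idx ` S)"

definition rank_oracle :: "'a set \<Rightarrow> ('a set \<Rightarrow> bool) \<Rightarrow> ('a \<Rightarrow> nat) \<Rightarrow> nat \<Rightarrow> nat" where
  "rank_oracle E indep idx c = rank indep {e \<in> E. idx e \<in> set_decode c}"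

end

theory Submission
  imports Defs
begin

text \<open>
  A greedy scan of \<open>S\<close> builds a set \<open>I\<close>, adding \<open>e\<close> iff every \<open>X \<subseteq> I\<close> satisfies
  \<open>card X + 2 \<le> 2 * r (insert e X)\<close>. The final \<open>I\<close> satisfies \<open>card (I \<inter> X) \<le> 2 * r X - 1\<close> for all
  nonempty \<open>X \<subseteq> S\<close>; the sets attaining equality cover \<open>S\<close> and are closed under union of
  intersecting pairs, so the maximal ones form a partition with sum \<open>card I\<close>, and no
  partition does better.

  Each test asks whether the submodular function \<open>F X = 2 * r (insert e X) - card X\<close> drops
  below \<open>2 = F {}\<close> on the subsets of \<open>I\<close>. This is answered by projected subgradient descent
  for the Lovasz extension on the integer grid \<open>{0..n}\<close>, where the grid points \<open>0\<close> and \<open>n\<close>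
  stand for membership and non-membership. All gains are \<open>1\<close> or \<open>-1\<close>. If \<open>F Z \<le> 1\<close>, but no
  prefix of the order by the current coordinates has a value below \<open>2\<close>, then the squared
  distance to the grid point of \<open>Z\<close> drops by at least \<open>n\<close> in a round. It starts at no more
  than \<open>n ^ 3\<close>, so \<open>n ^ 2 + 1\<close> rounds decide the test.
\<close>

section \<open>A total fragment of the algorithms\<close>

text \<open>The value on \<^const>\<open>Mu\<close> is junk; \<open>wf_alg\<close> excludes it and checks arities.\<close>

fun val :: "(nat \<Rightarrow> nat) \<Rightarrow> alg \<Rightarrow> nat list \<Rightarrow> nat" where
  "val orc Zero xs = 0"
| "val orc Succ xs = Suc (hd xs)"
| "val orc (Proj i) xs = xs ! i"
| "val orc Ask xs = orc (hd xs)"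
| "val orc (Comp f gs) xs = val orc f (map (\<lambda>g. val orc g xs) gs)"
| "val orc (PRec f g) xs =
     rec_nat (val orc f (tl xs)) (\<lambda>n u. val orc g (n # u # tl xs)) (hd xs)"
| "val orc (Mu f) xs = 0"

fun cost :: "(nat \<Rightarrow> nat) \<Rightarrow> alg \<Rightarrow> nat list \<Rightarrow> nat" where
  "cost orc Ask xs = 1"
| "cost orc (Comp f gs) xs =
     (\<Sum>g\<leftarrow>gs. cost orc g xs) + cost orc f (map (\<lambda>g. val orc g xs) gs)"
| "cost orc (PRec f g) xs =
     cost orc f (tl xs) + (\<Sum>n<hd xs. cost orc g (n # val orc (PRec f g) (n # tl xs) # tl xs))"
| "cost orc _ xs = 0"

fun wf_alg :: "nat \<Rightarrow> alg \<Rightarrow> bool" where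
  "wf_alg k Zero \<longleftrightarrow> True"
| "wf_alg k Succ \<longleftrightarrow> k = 1"
| "wf_alg k (Proj i) \<longleftrightarrow> i < k"
| "wf_alg k Ask \<longleftrightarrow> k = 1"
| "wf_alg k (Comp f gs) \<longleftrightarrow> (\<forall>g\<in>set gs. wf_alg k g) \<and> wf_alg (length gs) f"
| "wf_alg k (PRec f g) \<longleftrightarrow> 0 < k \<and> wf_alg (k - 1) f \<and> wf_alg (Suc k) g"
| "wf_alg k (Mu f) \<longleftrightarrow> False"

text \<open>Only \<open>Mu\<close> can diverge, and the arity check keeps every other scheme from
  getting stuck. Values and call counts thus become functions of the input, and the algorithm is
  analysed through \<open>val\<close> and \<open>cost\<close>.\<close>

lemma eval_val:
  "wf_alg (length xs) f \<Longrightarrow> eval orc f xs (val orc f xs) (cost orc f xs)"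
proof (induction f arbitrary: xs)
  case (Comp f gs)
  have "evals orc hs xs (map (\<lambda>g. val orc g xs) hs) (\<Sum>g\<leftarrow>hs. cost orc g xs)"
    if "set hs \<subseteq> set gs" for hs
    using that
  proof (induction hs)
    case (Cons h hs)
    with Comp show ?case by (auto intro!: eval_evals_search.Cons)
  qed (auto intro: eval_evals_search.Nil)
  with Comp show ?case by (auto intro!: eval_evals_search.Comp)
next
  case (PRec f g)
  then obtain m ys where xs: "xs = m # ys"
    by (cases xs) auto
  have "eval orc (PRec f g) (m # ys) (val orc (PRec f g) (m # ys)) (cost orc (PRec f g) (m # ys))"
  proof (induction m)
    case 0
    then show ?case using PRec xs by (auto intro: eval_evals_search.PRec_0)
  next
    case (Suc m)
    have "eval orc g (m # val orc (PRec f g) (m # ys) # ys)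
        (val orc g (m # val orc (PRec f g) (m # ys) # ys))
        (cost orc g (m # val orc (PRec f g) (m # ys) # ys))"
      using PRec.prems xs by (intro PRec.IH) auto
    from eval_evals_search.PRec_Suc[OF Suc this] show ?case
      by (simp add: add.assoc)
  qed
  with xs show ?case by simp
next
  case Succ
  then show ?case by (cases xs) (auto intro: eval_evals_search.Succ)
next
  case Ask
  then show ?case by (cases xs) (auto intro: eval_evals_search.Ask[simplified])
qed (auto intro: eval_evals_search.intros)

section \<open>Arithmetic without oracle calls\<close>

definition "One_alg = Comp Succ [Zero]"
definition "Add_alg = PRec (Proj 0) (Comp Succ [Proj 1])"
definition "Pred_alg = PRec Zero (Proj 0)"
text \<open>Recursion runs on the first argument, so the swap makes the subtrahend count the
  applications of the predecessor.\<close>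

definition "Sub_alg = Comp (PRec (Proj 0) (Comp Pred_alg [Proj 1])) [Proj 1, Proj 0]"
definition "Mult_alg = PRec Zero (Comp Add_alg [Proj 1, Proj 2])"
definition "Power_alg = Comp (PRec One_alg (Comp Mult_alg [Proj 1, Proj 2])) [Proj 1, Proj 0]"
text \<open>\<open>PRec Zero One_alg\<close> is the sign function, applied to the truncated
  difference.\<close>

definition "Less_alg = Comp (PRec Zero One_alg) [Comp Sub_alg [Proj 1, Proj 0]]"

text \<open>The recursion step sees the index, the accumulator and the \<open>k\<close> parameters;
  the projections drop the accumulator before \<open>f\<close> is called.\<close>

definition Sum_alg :: "nat \<Rightarrow> alg \<Rightarrow> alg" where
  "Sum_alg k f = PRec Zero (Comp Add_alg [Proj 1, Comp f (Proj 0 # map Proj [2..<Suc (Suc k)])])"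

lemma One_alg [simp]:
  "wf_alg k One_alg" "val orc One_alg xs = 1" "cost orc One_alg xs = 0"
  by (simp_all add: One_alg_def)

lemma Add_alg [simp]:
  "k = 2 \<Longrightarrow> wf_alg k Add_alg" "val orc Add_alg [x, y] = x + y" "cost orc Add_alg [x, y] = 0"
  unfolding Add_alg_def by (simp, induction x, simp_all)

lemma Pred_alg [simp]:
  "k = 1 \<Longrightarrow> wf_alg k Pred_alg" "val orc Pred_alg [x] = x - 1" "cost orc Pred_alg [x] = 0"
  unfolding Pred_alg_def by (simp, cases x, simp_all)

lemma Sub_alg [simp]:
  "k = 2 \<Longrightarrow> wf_alg k Sub_alg" "val orc Sub_alg [x, y] = x - y" "cost orc Sub_alg [x, y] = 0"
  unfolding Sub_alg_def by (simp, induction y, simp_all)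

lemma Mult_alg [simp]:
  "k = 2 \<Longrightarrow> wf_alg k Mult_alg" "val orc Mult_alg [x, y] = x * y" "cost orc Mult_alg [x, y] = 0"
  unfolding Mult_alg_def by (simp, induction x, simp_all)

lemma Power_alg [simp]:
  "k = 2 \<Longrightarrow> wf_alg k Power_alg" "val orc Power_alg [x, y] = x ^ y" "cost orc Power_alg [x, y] = 0"
  unfolding Power_alg_def by (simp, induction y, simp_all)

lemma Less_alg [simp]:
  "k = 2 \<Longrightarrow> wf_alg k Less_alg" "val orc Less_alg [x, y] = of_bool (x < y)"
  "cost orc Less_alg [x, y] = 0"
  unfolding Less_alg_def by (simp, cases "y - x", simp_all)

lemma map_val_Proj: "map (\<lambda>g. val orc g xs) (map Proj [i..<j]) = map ((!) xs) [i..<j]"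
  by simp

lemma Sum_alg:
  "l = Suc k \<Longrightarrow> wf_alg l f \<Longrightarrow> wf_alg l (Sum_alg k f)"
  "length xs = k \<Longrightarrow> val orc (Sum_alg k f) (N # xs) = (\<Sum>i<N. val orc f (i # xs))"
  "length xs = k \<Longrightarrow> cost orc (Sum_alg k f) (N # xs) = (\<Sum>i<N. cost orc f (i # xs))"
proof -
  assume "l = Suc k" "wf_alg l f"
  then show "wf_alg l (Sum_alg k f)" by (auto simp: Sum_alg_def simp del: upt_Suc)
next
  assume [simp]: "length xs = k"
  have nth: "map ((!) (i # u # xs)) [2..<Suc (Suc k)] = xs" for i u
    by (rule nth_equalityI) (simp_all del: upt_Suc)
  have nth': "map (\<lambda>g. val orc g (i # u # xs)) (map Proj [2..<Suc (Suc k)]) = xs" for i u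
    by (simp only: map_val_Proj nth)
  show "val orc (Sum_alg k f) (N # xs) = (\<Sum>i<N. val orc f (i # xs))"
    by (induction N) (simp_all add: Sum_alg_def nth' del: map_map upt_Suc)
  have c0: "(\<Sum>g\<leftarrow>map Proj js. cost orc g ys) = 0" for js ys
    by (induction js) auto
  show "cost orc (Sum_alg k f) (N # xs) = (\<Sum>i<N. cost orc f (i # xs))"
    by (simp add: Sum_alg_def nth' c0 del: map_map upt_Suc)
qed

text \<open>The quotient counts the \<open>k < x\<close> with \<open>Suc k * y \<le> x\<close>,
  written \<open>k * y < Suc x - y\<close>; this bounded count avoids a search by
  \<open>Mu\<close>.\<close>

definition "Div_alg = Comp (Sum_alg 2 (Comp Less_alg
   [Comp Mult_alg [Proj 0, Proj 2], Comp Sub_alg [Comp Succ [Proj 1], Proj 2]])) [Proj 0, Proj 0, Proj 1]"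

definition digit :: "nat \<Rightarrow> nat \<Rightarrow> nat \<Rightarrow> nat" where
  "digit b c i = c div b ^ i mod b"

lemma sum_div: "0 < b \<Longrightarrow> (\<Sum>k<a. of_bool (k * b < Suc a - b)) = a div (b::nat)"
proof -
  assume b: "0 < b"
  have "k * b < Suc a - b \<longleftrightarrow> k < a div b" for k
    using b less_eq_div_iff_mult_less_eq[of b "Suc k" a] by auto
  moreover have "k < a" if "k < a div b" for k
    using that div_le_dividend[of a b] by linarith
  ultimately have "{..<a} \<inter> {k. k * b < Suc a - b} = {..<a div b}" by blast
  then have "card ({..<a} \<inter> {k. k * b < Suc a - b}) = a div b" by simp
  then show ?thesis by simp
qed

lemma Div_alg [simp]:
  "k = 2 \<Longrightarrow> wf_alg k Div_alg" "0 < y \<Longrightarrow> val orc Div_alg [x, y] = x div y"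
  "cost orc Div_alg [x, y] = 0"
  unfolding Div_alg_def
  by (simp_all add: Sum_alg sum_div del: sum_of_bool_eq)


section \<open>The algorithm\<close>

definition "Two_alg = Comp Succ [One_alg]"

lemma Two_alg [simp]:
  "wf_alg k Two_alg" "val orc Two_alg xs = 2" "cost orc Two_alg xs = 0"
  by (simp_all add: Two_alg_def)

definition "Digit_alg =
  Comp (Comp Sub_alg [Proj 0, Comp Mult_alg [Proj 1, Comp Div_alg [Proj 0, Proj 1]]])
    [Comp Div_alg [Proj 1, Comp Power_alg [Proj 0, Proj 2]], Proj 0]"

lemma Digit_alg [simp]:
  "k = 3 \<Longrightarrow> wf_alg k Digit_alg"
  "0 < b \<Longrightarrow> val orc Digit_alg [b, c, i] = digit b c i"
  "cost orc Digit_alg [b, c, i] = 0"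
  by (simp_all add: Digit_alg_def digit_def minus_mult_div_eq_mod)

text \<open>
  Sets are coded by their binary digits, grid points \<open>z\<close> by their digits in base \<open>n + 1\<close>.
  For indices below \<open>n\<close>, the key orders lexicographically by coordinate and index.
\<close>

definition key :: "nat \<Rightarrow> nat \<Rightarrow> nat \<Rightarrow> nat" where
  "key n z j = digit (Suc n) z j * n + j"

definition "Key_alg = Comp Add_alg
  [Comp Mult_alg [Comp Digit_alg [Comp Succ [Proj 2], Proj 1, Proj 0], Proj 2], Proj 0]"

lemma Key_alg [simp]:
  "k = 3 \<Longrightarrow> wf_alg k Key_alg" "val orc Key_alg [j, z, n] = key n z j"
  "cost orc Key_alg [j, z, n] = 0"
  by (simp_all add: Key_alg_def key_def)

text \<open>The offset decides about \<open>i\<close> itself: \<open>d = 0\<close> excludes it from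
  the prefix, \<open>d = 1\<close> admits it.\<close>

definition precedes :: "nat \<Rightarrow> nat \<Rightarrow> nat \<Rightarrow> nat \<Rightarrow> nat \<Rightarrow> nat \<Rightarrow> nat" where
  "precedes n I z i d j = digit 2 I j * of_bool (key n z j < key n z i + d)"

definition "Precedes_alg = Comp Mult_alg
  [Comp Digit_alg [Two_alg, Proj 4, Proj 0],
   Comp Less_alg [Comp Key_alg [Proj 0, Proj 3, Proj 5],
     Comp Add_alg [Comp Key_alg [Proj 2, Proj 3, Proj 5], Proj 1]]]"

lemma Precedes_alg [simp]:
  "k = 6 \<Longrightarrow> wf_alg k Precedes_alg"
  "val orc Precedes_alg [j, d, i, z, I, n] = precedes n I z i d j"
  "cost orc Precedes_alg [j, d, i, z, I, n] = 0"
  by (simp_all add: Precedes_alg_def precedes_def)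

text \<open>The query is the code of the prefix together with \<open>e\<close>, provided that \<open>e\<close> is not in the set \<open>I\<close>.\<close>

definition prefix_rank :: "(nat \<Rightarrow> nat) \<Rightarrow> nat \<Rightarrow> nat \<Rightarrow> nat \<Rightarrow> nat \<Rightarrow> nat \<Rightarrow> nat \<Rightarrow> nat" where
  "prefix_rank orc n I e z i d = orc (2 ^ e + (\<Sum>j<n. precedes n I z i d j * 2 ^ j))"

definition "Prefix_rank_alg = Comp Ask [Comp Add_alg
  [Comp Power_alg [Two_alg, Proj 3],
   Comp (Sum_alg 5 (Comp Mult_alg [Comp Precedes_alg (map Proj [0..<6]),
     Comp Power_alg [Two_alg, Proj 0]]))
   [Proj 5, Proj 0, Proj 1, Proj 2, Proj 4, Proj 5]]]"

lemma Prefix_rank_alg [simp]: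
  "k = 6 \<Longrightarrow> wf_alg k Prefix_rank_alg"
  "val orc Prefix_rank_alg [d, i, z, e, I, n] = prefix_rank orc n I e z i d"
  "cost orc Prefix_rank_alg [d, i, z, e, I, n] = 1"
  by (simp_all add: Prefix_rank_alg_def prefix_rank_def Sum_alg upt_rec)

definition violated :: "(nat \<Rightarrow> nat) \<Rightarrow> nat \<Rightarrow> nat \<Rightarrow> nat \<Rightarrow> nat \<Rightarrow> nat \<Rightarrow> nat" where
  "violated orc n I e z i = digit 2 I i *
     of_bool (2 * prefix_rank orc n I e z i 1 < 2 + (\<Sum>j<n. precedes n I z i 1 j))"

definition "Violated_alg = Comp Mult_alg
  [Comp Digit_alg [Two_alg, Proj 3, Proj 0],
   Comp Less_alg
     [Comp Mult_alg [Two_alg,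
        Comp Prefix_rank_alg [One_alg, Proj 0, Proj 1, Proj 2, Proj 3, Proj 4]],
      Comp Add_alg [Two_alg,
        Comp (Sum_alg 5 Precedes_alg) [Proj 4, One_alg, Proj 0, Proj 1, Proj 3, Proj 4]]]]"

lemma Violated_alg [simp]:
  "k = 5 \<Longrightarrow> wf_alg k Violated_alg"
  "val orc Violated_alg [i, z, e, I, n] = violated orc n I e z i"
  "cost orc Violated_alg [i, z, e, I, n] = 1"
  by (simp_all add: Violated_alg_def violated_def Sum_alg)

text \<open>The coordinate moves by the gain \<open>\<plusminus>1\<close>, clipped to \<open>{0..n}\<close>: below by truncated subtraction.\<close>

definition new_digit :: "(nat \<Rightarrow> nat) \<Rightarrow> nat \<Rightarrow> nat \<Rightarrow> nat \<Rightarrow> nat \<Rightarrow> nat \<Rightarrow> nat" where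
  "new_digit orc n I e z i =
     min n (digit (Suc n) z i + 2 * prefix_rank orc n I e z i 1
            - Suc (2 * prefix_rank orc n I e z i 0))"

text \<open>The outer composition is \<open>n - (n - x)\<close>, which for truncated subtraction is
  \<open>min n x\<close>.\<close>

definition "New_digit_alg =
  Comp (Comp Sub_alg [Proj 1, Comp Sub_alg [Proj 1, Proj 0]])
  [Comp Sub_alg
     [Comp Add_alg [Comp Digit_alg [Comp Succ [Proj 4], Proj 1, Proj 0],
        Comp Mult_alg [Two_alg,
          Comp Prefix_rank_alg [One_alg, Proj 0, Proj 1, Proj 2, Proj 3, Proj 4]]],
      Comp Succ [Comp Mult_alg [Two_alg,
        Comp Prefix_rank_alg [Zero, Proj 0, Proj 1, Proj 2, Proj 3, Proj 4]]]],
   Proj 4]"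

lemma New_digit_alg [simp]:
  "k = 5 \<Longrightarrow> wf_alg k New_digit_alg"
  "val orc New_digit_alg [i, z, e, I, n] = new_digit orc n I e z i"
  "cost orc New_digit_alg [i, z, e, I, n] = 2"
  by (simp_all add: New_digit_alg_def new_digit_def min_def)

definition update :: "(nat \<Rightarrow> nat) \<Rightarrow> nat \<Rightarrow> nat \<Rightarrow> nat \<Rightarrow> nat \<Rightarrow> nat" where
  "update orc n I e z = (\<Sum>i<n. new_digit orc n I e z i * Suc n ^ i)"

definition "Update_alg = Comp (Sum_alg 4 (Comp Mult_alg
   [Comp New_digit_alg (map Proj [0..<5]), Comp Power_alg [Comp Succ [Proj 4], Proj 0]]))
  [Proj 3, Proj 0, Proj 1, Proj 2, Proj 3]"

lemma Update_alg [simp]: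
  "k = 4 \<Longrightarrow> wf_alg k Update_alg"
  "val orc Update_alg [z, e, I, n] = update orc n I e z"
  "cost orc Update_alg [z, e, I, n] = 2 * n"
  by (simp_all add: Update_alg_def update_def Sum_alg upt_rec del: power_Suc)

definition "Iterate_alg = PRec Zero (Comp Update_alg (map Proj [1..<5]))"

lemma Iterate_alg [simp]:
  "k = 4 \<Longrightarrow> wf_alg k Iterate_alg"
  "val orc Iterate_alg [t, e, I, n] = (update orc n I e ^^ t) 0"
  "cost orc Iterate_alg [t, e, I, n] = t * (2 * n)"
  unfolding Iterate_alg_def by (simp add: upt_rec, induction t, simp_all add: upt_rec)

definition violations :: "(nat \<Rightarrow> nat) \<Rightarrow> nat \<Rightarrow> nat \<Rightarrow> nat \<Rightarrow> nat" where
  "violations orc n I e =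
     (\<Sum>t<Suc (n ^ 2). \<Sum>i<n. violated orc n I e ((update orc n I e ^^ t) 0) i)"

text \<open>Each round recomputes its grid point from the start: \<open>t * (2 * n)\<close> calls
  for the point and \<open>n\<close> for the tests.\<close>

definition "Violations_alg =
  Comp (Sum_alg 3 (Comp (Sum_alg 4 Violated_alg) [Proj 3, Iterate_alg, Proj 1, Proj 2, Proj 3]))
    [Comp Succ [Comp Power_alg [Proj 2, Two_alg]], Proj 0, Proj 1, Proj 2]"

lemma Violations_alg [simp]:
  "k = 3 \<Longrightarrow> wf_alg k Violations_alg"
  "val orc Violations_alg [e, I, n] = violations orc n I e"
  "cost orc Violations_alg [e, I, n] = (\<Sum>t<Suc (n ^ 2). t * (2 * n) + n)"
  by (simp_all add: Violations_alg_def violations_def Sum_alg del: sum.lessThan_Suc)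

fun greedy :: "(nat \<Rightarrow> nat) \<Rightarrow> nat \<Rightarrow> nat \<Rightarrow> nat \<Rightarrow> nat" where
  "greedy orc n S 0 = 0"
| "greedy orc n S (Suc e) = greedy orc n S e +
     digit 2 S e * of_bool (violations orc n (greedy orc n S e) e < 1) * 2 ^ e"

definition "Greedy_alg = PRec Zero (Comp Add_alg [Proj 1,
  Comp Mult_alg
    [Comp Mult_alg [Comp Digit_alg [Two_alg, Proj 3, Proj 0],
       Comp Less_alg [Comp Violations_alg [Proj 0, Proj 1, Proj 2], One_alg]],
     Comp Power_alg [Two_alg, Proj 0]]])"

lemma Greedy_alg [simp]:
  "k = 3 \<Longrightarrow> wf_alg k Greedy_alg"
  "val orc Greedy_alg [e, n, S] = greedy orc n S e"
  "cost orc Greedy_alg [e, n, S] = e * (\<Sum>t<Suc (n ^ 2). t * (2 * n) + n)"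
  unfolding Greedy_alg_def by (simp, induction e, simp_all del: sum.lessThan_Suc)

definition "Main_alg = Comp (Sum_alg 1 (Comp Digit_alg [Two_alg, Proj 1, Proj 0]))
  [Proj 0, Comp Greedy_alg [Proj 0, Proj 0, Proj 1]]"

lemma Main_alg:
  "wf_alg 2 Main_alg"
  "val orc Main_alg [n, S] = (\<Sum>i<n. digit 2 (greedy orc n S n) i)"
  "cost orc Main_alg [n, S] = n * (\<Sum>t<Suc (n ^ 2). t * (2 * n) + n)"
  by (simp_all add: Main_alg_def Sum_alg del: sum.lessThan_Suc)

section \<open>Rank functions and sparse sets\<close>

context matroid
begin

lemma indep_finite: "indep X \<Longrightarrow> finite X"
  by (rule finite_subset[OF indep_subset_ground finite_ground])

lemma finite_indep: "finite {X. X \<subseteq> S \<and> indep X}"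
  by (rule finite_subset[of _ "Pow E"]) (use indep_subset_ground finite_ground in auto)

lemma card_le_rank: "indep X \<Longrightarrow> X \<subseteq> S \<Longrightarrow> card X \<le> rank indep S"
  unfolding rank_def by (intro Max_ge) (use finite_indep in auto)

lemma rank_attained: "\<exists>X\<subseteq>S. indep X \<and> card X = rank indep S"
proof -
  have "rank indep S \<in> card ` {X. X \<subseteq> S \<and> indep X}"
    unfolding rank_def by (intro Max_in) (use finite_indep indep_empty in auto)
  then show ?thesis by auto
qed

text \<open>A largest independent set between \<open>X\<close> and \<open>S\<close> has full rank,
  since otherwise exchange with a set attaining the rank would enlarge it.\<close>

lemma extend_indep:
  assumes "indep X" "X \<subseteq> S"
  shows "\<exists>J. X \<subseteq> J \<and> J \<subseteq> S \<and> indep J \<and> card J = rank indep S"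
proof -
  let ?F = "{J. X \<subseteq> J \<and> J \<subseteq> S \<and> indep J}"
  have "finite ?F" by (rule finite_subset[OF _ finite_indep[of S]]) auto
  then have "finite (card ` ?F)" "card ` ?F \<noteq> {}" using assms by auto
  from Max_in[OF this] obtain J where J: "J \<in> ?F" "card J = Max (card ` ?F)" by auto
  have "\<not> card J < rank indep S"
  proof
    assume "card J < rank indep S"
    then obtain K where "K \<subseteq> S" "indep K" "card J < card K"
      using rank_attained[of S] by auto
    then obtain y where y: "y \<in> S" "y \<notin> J" "indep (insert y J)"
      using indep_exchange[of J K] J(1) by auto
    have "finite J" using J(1) indep_finite by simp
    moreover have "card (insert y J) \<le> card J"
      unfolding J(2) by (intro Max_ge) (use \<open>finite (card ` ?F)\<close> J y in auto)
    ultimately show False using y by simp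
  qed
  with card_le_rank[of J S] J show ?thesis by (intro exI[of _ J]) auto
qed

lemma rank_mono: "A \<subseteq> B \<Longrightarrow> rank indep A \<le> rank indep B"
  using rank_attained[of A] card_le_rank[of _ B] by fastforce

lemma rank_insert_le: "rank indep (insert x A) \<le> Suc (rank indep A)"
proof -
  obtain X where X: "X \<subseteq> insert x A" "indep X" "card X = rank indep (insert x A)"
    using rank_attained by blast
  have "card (X - {x}) \<le> rank indep A"
    using X by (intro card_le_rank) (auto intro: indep_mono)
  moreover have "card X \<le> Suc (card (X - {x}))"
    by (auto simp: card_Diff_singleton_if)
  ultimately show ?thesis using X by simp
qed

text \<open>If \<open>x\<close> raises the rank of \<open>B\<close>, extend a maximum independent
  set \<open>JA\<close> of \<open>A\<close> to one of \<open>B\<close>, called \<open>JB\<close>.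
  Exchange with a maximum set of \<open>insert x B\<close> enlarges \<open>JB\<close> by an element
  that cannot lie in \<open>B\<close>, hence by \<open>x\<close>; so \<open>x\<close> also extends
  \<open>JA\<close>.\<close>

lemma rank_diminishing_returns:
  assumes "A \<subseteq> B"
  shows "rank indep (insert x B) + rank indep A \<le> rank indep (insert x A) + rank indep B"
proof (cases "rank indep (insert x B) = rank indep B")
  case True
  then show ?thesis using rank_mono[of A "insert x A"] by auto
next
  case False
  then have B: "rank indep (insert x B) = Suc (rank indep B)"
    using rank_insert_le[of x B] rank_mono[OF subset_insertI[of B x]] by linarith
  obtain JA where JA: "JA \<subseteq> A" "indep JA" "card JA = rank indep A"
    using rank_attained by blast
  obtain JB where JB: "JA \<subseteq> JB" "JB \<subseteq> B" "indep JB" "card JB = rank indep B"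
    using extend_indep[OF JA(2), of B] JA assms by auto
  obtain K where K: "K \<subseteq> insert x B" "indep K" "card K = rank indep (insert x B)"
    using rank_attained by blast
  obtain y where y: "y \<in> K" "y \<notin> JB" "indep (insert y JB)"
    using indep_exchange[OF JB(3) K(2)] JB K B by auto
  have fin: "finite JB" using JB indep_finite by simp
  have "y \<notin> B"
    using card_le_rank[OF y(3), of B] y JB fin by auto
  then have "y = x" using y K by auto
  then have "indep (insert x JA)" "x \<notin> JA"
    using y JB indep_mono[OF y(3), of "insert x JA"] by auto
  then have "Suc (rank indep A) \<le> rank indep (insert x A)"
    using card_le_rank[of "insert x JA" "insert x A"] JA fin JB finite_subset[of JA JB] by auto
  then show ?thesis using B by simp
qed

end

text \<open>There is no ground set, so that the matroid rank can be transported to sets of natural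
  numbers; numbers that stand for no element then behave like loops.\<close>

locale rank_function =
  fixes r :: "'b set \<Rightarrow> nat"
  assumes rank_empty: "r {} = 0"
    and mono: "A \<subseteq> B \<Longrightarrow> r A \<le> r B"
    and insert_le: "r (insert x A) \<le> Suc (r A)"
    and diminishing_returns: "A \<subseteq> B \<Longrightarrow> r (insert x B) + r A \<le> r (insert x A) + r B"
begin

text \<open>Adding the elements of \<open>B\<close> one at a time to \<open>A\<close> and to
  \<open>A \<inter> B\<close>, diminishing returns compares the increments.\<close>

lemma submodular:
  assumes "finite B"
  shows "r (A \<union> B) + r (A \<inter> B) \<le> r A + r B"
proof -
  have "r (A \<union> C) + r D \<le> r A + r (D \<union> C)" if "finite C" "D \<subseteq> A" for C D
    using that
  proof (induction C)
    case (insert x C)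
    then show ?case
      using diminishing_returns[OF Un_mono[OF insert.prems subset_refl[of C]], of x] by auto
  qed simp
  from this[OF assms, of "A \<inter> B"] show ?thesis by (simp add: Un_absorb1)
qed

text \<open>For finite sets this is independence in the matroid induced by
  \<open>2 * r X - 1\<close>; the strict form avoids truncated subtraction.\<close>

definition sparse :: "'b set \<Rightarrow> bool" where
  "sparse I \<longleftrightarrow> (\<forall>X\<subseteq>I. X \<noteq> {} \<longrightarrow> card X < 2 * r X)"

text \<open>Only sets containing \<open>e\<close> are new, and the bound on \<open>X - {e}\<close>
  leaves room for one more element.\<close>

lemma sparse_insert:
  assumes "sparse I" "finite I" "\<And>X. X \<subseteq> I \<Longrightarrow> card X + 2 \<le> 2 * r (insert e X)"
  shows "sparse (insert e I)"
  unfolding sparse_def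
proof (intro allI impI)
  fix X assume X: "X \<subseteq> insert e I" "X \<noteq> {}"
  show "card X < 2 * r X"
  proof (cases "e \<in> X")
    case True
    then have "X = insert e (X - {e})" by auto
    moreover have "card X \<le> Suc (card (X - {e}))"
      by (auto simp: card_Diff_singleton_if)
    moreover have "card (X - {e}) + 2 \<le> 2 * r (insert e (X - {e}))"
      using X by (intro assms) auto
    ultimately show ?thesis by simp
  next
    case False
    with X assms show ?thesis unfolding sparse_def by auto
  qed
qed

section \<open>Tight sets and the optimal partition\<close>

context
  fixes S I :: "'b set"
  assumes fin: "finite S" and sub: "I \<subseteq> S" and sparse: "sparse I"
    and singleton: "\<And>x. x \<in> S \<Longrightarrow> r {x} = 1"
begin

text \<open>Sparsity of \<open>I \<inter> X\<close> gives the bound unless this set is empty; then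
  \<open>X\<close> still has positive rank because its singletons do.\<close>

lemma card_Int_less:
  assumes "X \<subseteq> S" "X \<noteq> {}"
  shows "card (I \<inter> X) < 2 * r X"
proof (cases "I \<inter> X = {}")
  case True
  obtain x where "x \<in> X" using assms by auto
  then have "r {x} \<le> r X" "r {x} = 1"
    using assms singleton[of x] mono[of "{x}" X] by auto
  with True show ?thesis by simp
next
  case False
  then have "card (I \<inter> X) < 2 * r (I \<inter> X)" using sparse unfolding sparse_def by auto
  also have "\<dots> \<le> 2 * r X" by (simp add: mono)
  finally show ?thesis .
qed

lemma card_eq_sum_partition:
  assumes "partition_on S P"
  shows "card I = (\<Sum>X\<in>P. card (I \<inter> X))"
proof -
  have "card (\<Union>X\<in>P. I \<inter> X) = (\<Sum>X\<in>P. card (I \<inter> X))"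
  proof (rule card_UN_disjoint)
    show "finite P" using assms fin by (rule finite_elements[rotated])
    show "\<forall>X\<in>P. finite (I \<inter> X)" using fin sub finite_subset by blast
    show "\<forall>X\<in>P. \<forall>Y\<in>P. X \<noteq> Y \<longrightarrow> (I \<inter> X) \<inter> (I \<inter> Y) = {}"
      using partition_onD2[OF assms] by (auto simp: disjoint_def)
  qed
  moreover have "(\<Union>X\<in>P. I \<inter> X) = I" using partition_onD1[OF assms] sub by auto
  ultimately show ?thesis by simp
qed

lemma card_le_partition_sum:
  assumes "partition_on S P"
  shows "int (card I) \<le> (\<Sum>X\<in>P. 2 * int (r X) - 1)"
proof -
  have "int (card (I \<inter> X)) \<le> 2 * int (r X) - 1" if "X \<in> P" for X
    using card_Int_less[of X] that partition_onD1[OF assms] partition_onD3[OF assms] by fastforce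
  then show ?thesis
    unfolding card_eq_sum_partition[OF assms] of_nat_sum by (rule sum_mono)
qed

definition "tight X \<longleftrightarrow> X \<subseteq> S \<and> X \<noteq> {} \<and> Suc (card (I \<inter> X)) = 2 * r X"

text \<open>Uncrossing: \<open>card (I \<inter> X)\<close> is modular and \<open>r\<close>
  submodular. As \<open>A \<inter> B\<close> is nonempty, the strict bound holds for both union and
  intersection, so neither can have any excess.\<close>

lemma tight_Un:
  assumes "tight A" "tight B" "A \<inter> B \<noteq> {}"
  shows "tight (A \<union> B)"
proof -
  have [simp]: "finite A" "finite B" using assms fin finite_subset unfolding tight_def by blast+
  have "card (I \<inter> (A \<union> B)) + card (I \<inter> (A \<inter> B)) = card (I \<inter> A) + card (I \<inter> B)"
    using card_Un_Int[of "I \<inter> A" "I \<inter> B"] by (simp add: Int_Un_distrib Int_ac)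
  moreover have "card (I \<inter> (A \<union> B)) < 2 * r (A \<union> B)" "card (I \<inter> (A \<inter> B)) < 2 * r (A \<inter> B)"
    using assms unfolding tight_def by (auto intro!: card_Int_less)
  moreover have "r (A \<union> B) + r (A \<inter> B) \<le> r A + r B" by (rule submodular) simp
  ultimately show ?thesis using assms unfolding tight_def by auto
qed

text \<open>The blocks are the maximal tight sets: tight sets cover \<open>S\<close>, and uncrossing
  makes the maximal ones disjoint. Each block contributes exactly
  \<open>card (I \<inter> X)\<close>.\<close>

lemma ex_partition_sum_eq_card:
  assumes "\<And>x. x \<in> S - I \<Longrightarrow> \<exists>X\<subseteq>I. 2 * r (insert x X) < card X + 2"
  shows "\<exists>P. partition_on S P \<and> (\<Sum>X\<in>P. 2 * int (r X) - 1) = int (card I)"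
proof -
  have ex: "\<exists>X. tight X \<and> x \<in> X" if x: "x \<in> S" for x
  proof (cases "x \<in> I")
    case True
    then have "tight {x}" using x singleton unfolding tight_def by simp
    then show ?thesis by auto
  next
    case False
    with x assms obtain X where X: "X \<subseteq> I" "2 * r (insert x X) < card X + 2" by blast
    have "r {x} \<le> r (insert x X)" by (rule mono) auto
    with x singleton have 1: "1 \<le> r (insert x X)" by simp
    with X have "X \<noteq> {}" by auto
    \<comment> \<open>Sparsity and the failed test squeeze \<open>2 * r (insert x X)\<close>
      strictly between \<open>card X\<close> and \<open>card X + 2\<close>, which is
      tightness.\<close>
    with X sparse have "card X < 2 * r X" unfolding sparse_def by auto
    moreover have "r X \<le> r (insert x X)" by (rule mono) auto
    moreover have "I \<inter> insert x X = X" using X False by auto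
    ultimately have "tight (insert x X)" using X sub x unfolding tight_def by auto
    then show ?thesis by auto
  qed
  define P where "P = {X. tight X \<and> (\<forall>Y. tight Y \<longrightarrow> X \<subseteq> Y \<longrightarrow> Y = X)}"
  have P: "partition_on S P"
  proof (rule partition_onI)
    show "\<Union>P = S"
    proof (rule equalityI)
      show "\<Union>P \<subseteq> S" by (auto simp: P_def tight_def)
      show "S \<subseteq> \<Union>P"
      proof
        fix x assume "x \<in> S"
        then obtain X where X: "tight X" "x \<in> X" using ex by blast
        have "finite {X. tight X}"
          by (rule finite_subset[of _ "Pow S"]) (use fin in \<open>auto simp: tight_def\<close>)
        from finite_has_maximal2[OF this, of X] X show "x \<in> \<Union>P"
          by (auto simp: P_def)
      qed
    qed
    show "disjnt X Y" if "X \<in> P" "Y \<in> P" "X \<noteq> Y" for X Y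
    proof (rule ccontr)
      assume "\<not> disjnt X Y"
      with that have "tight (X \<union> Y)" by (intro tight_Un) (auto simp: P_def disjnt_def)
      with that show False unfolding P_def by blast
    qed
    show "{} \<notin> P" by (simp add: P_def tight_def)
  qed
  have "2 * int (r X) - 1 = int (card (I \<inter> X))" if "X \<in> P" for X
    using that by (auto simp: P_def tight_def)
  then have "(\<Sum>X\<in>P. 2 * int (r X) - 1) = (\<Sum>X\<in>P. int (card (I \<inter> X)))"
    by (rule sum.cong[OF refl])
  with P card_eq_sum_partition[OF P] show ?thesis by auto
qed

end

end

section \<open>Subgradient descent\<close>

context rank_function
begin

context
  fixes I :: "'b set" and e :: 'b and k :: "'b \<Rightarrow> nat"
begin

definition below :: "'b \<Rightarrow> 'b set" where
  "below i = {j \<in> I. k j < k i}"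

definition slack :: "'b set \<Rightarrow> int" where
  "slack X = 2 * int (r (insert e X)) - int (card X)"

text \<open>This is the increment of \<open>slack\<close> when \<open>i\<close> joins its
  predecessors, a coordinate of the vertex found by Edmonds' greedy algorithm for this
  order.\<close>

definition gain :: "'b \<Rightarrow> int" where
  "gain i = 2 * int (r (insert e (insert i (below i)))) - 2 * int (r (insert e (below i))) - 1"

lemma gain_cases: "gain i = 1 \<or> gain i = - 1"
proof -
  have "r (insert e (below i)) \<le> r (insert e (insert i (below i)))" by (rule mono) auto
  with insert_le[of i "insert e (below i)"] show ?thesis
    unfolding gain_def insert_commute[of i e] by force
qed

context
  assumes finI: "finite I" and inj: "inj_on k I" and e: "r {e} = 1"
begin

lemma slack_empty: "slack {} = 2"
  by (simp add: slack_def e)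

text \<open>The sum telescopes: the last element of an initial segment has exactly the other
  elements below it.\<close>

lemma sum_gain_initial:
  assumes "U \<subseteq> I" "\<And>i j. i \<in> U \<Longrightarrow> j \<in> I \<Longrightarrow> k j < k i \<Longrightarrow> j \<in> U"
  shows "sum gain U = slack U - 2"
proof -
  have "finite U" using assms finI finite_subset by blast
  then show ?thesis using assms
  proof (induction U rule: finite_ranking_induct[where f = k])
    case empty
    then show ?case by (simp add: slack_empty)
  next
    case (insert x U)
    show ?case
    proof (cases "x \<in> U")
      case True
      with insert show ?thesis by (simp add: insert_absorb)
    next
      case False
      have "sum gain U = slack U - 2"
      proof (rule insert.IH)
        show "j \<in> U" if "i \<in> U" "j \<in> I" "k j < k i" for i j
          using insert.prems(2)[of i j] insert.hyps(2)[of i] that by auto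
      qed (use insert.prems in auto)
      moreover have "below x = U"
      proof (rule set_eqI)
        fix j
        have "k j \<noteq> k x" if "j \<in> U"
          using inj_onD[OF inj, of j x] that False insert.prems(1) by auto
        then show "j \<in> below x \<longleftrightarrow> j \<in> U"
          using insert.prems insert.hyps(2)[of j] unfolding below_def by fastforce
      qed
      ultimately show ?thesis
        using False insert.hyps(1) by (simp add: gain_def slack_def insert_commute)
    qed
  qed
qed

text \<open>Adding the elements of \<open>Z\<close> in order, each joins a subset of its
  predecessors, so by diminishing returns the slack grows by at least its gain.\<close>

lemma sum_gain_le:
  assumes "Z \<subseteq> I"
  shows "sum gain Z \<le> slack Z - 2"
proof -
  have "finite Z" using assms finI finite_subset by blast
  then show ?thesis using assms
  proof (induction Z rule: finite_ranking_induct[where f = k])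
    case empty
    then show ?case by (simp add: slack_empty)
  next
    case (insert x Z)
    show ?case
    proof (cases "x \<in> Z")
      case True
      with insert show ?thesis by (simp add: insert_absorb)
    next
      case False
      have "j \<in> below x" if "j \<in> Z" for j
        using that insert.hyps(2)[of j] inj_onD[OF inj, of j x] insert.prems False
        unfolding below_def by fastforce
      then have "insert e Z \<subseteq> insert e (below x)" by blast
      from diminishing_returns[OF this, of x] insert False show ?thesis
        by (simp add: gain_def slack_def insert_commute)
    qed
  qed
qed

end

end

end

locale nat_rank_function = rank_function r for r :: "nat set \<Rightarrow> nat"
begin

text \<open>The gains have inner product at least \<open>n\<close> with the direction towards the
  point of \<open>Z\<close>. In the expanded square this contributes at most \<open>- 2 * n\<close>,
  while the squared unit moves add \<open>card I \<le> n\<close>.\<close>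

lemma descent_step:
  fixes I Z :: "nat set" and e n :: nat and z z' :: "nat \<Rightarrow> nat"
  defines "k \<equiv> \<lambda>j. z j * n + j"
  defines "D \<equiv> \<lambda>y. \<Sum>i\<in>I. (int (y i) - (if i \<in> Z then 0 else int n))\<^sup>2"
  assumes I: "I \<subseteq> {..<n}" and e: "r {e} = 1" and Z: "Z \<subseteq> I" "2 * r (insert e Z) < card Z + 2"
    and zn: "\<And>i. i \<in> I \<Longrightarrow> z i \<le> n"
    and ok: "\<And>i. i \<in> I \<Longrightarrow>
      card {j\<in>I. k j < k i + 1} + 2 \<le> 2 * r (insert e {j\<in>I. k j < k i + 1})"
    and z': "\<And>i. i \<in> I \<Longrightarrow> z' i = min n (z i + 2 * r (insert e {j\<in>I. k j < k i + 1})
        - Suc (2 * r (insert e {j\<in>I. k j < k i})))"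
  shows "D z' \<le> D z - int n"
proof -
  have finI: "finite I" using I finite_subset by blast
  \<comment> \<open>The index part is below \<open>n\<close>, so it never carries into the
    coordinate.\<close>
  have mono_k: "z j \<le> z i" if "k j \<le> k i" "i \<in> I" for i j
  proof -
    have "z j * n < Suc (z i) * n" using that I unfolding k_def by auto
    then have "z j < Suc (z i)" by (rule mult_less_cancel2[THEN iffD1, THEN conjunct2])
    then show ?thesis by simp
  qed
  have inj: "inj_on k I"
  proof (rule inj_onI)
    fix i j assume "i \<in> I" "j \<in> I" "k i = k j"
    moreover from this have "z i = z j" using mono_k[of i j] mono_k[of j i] by auto
    ultimately show "i = j" by (simp add: k_def)
  qed
  have pre: "{j\<in>I. k j < k i + 1} = insert i (below I k i)" if "i \<in> I" for i
    using that inj_onD[OF inj] by (auto simp: below_def less_Suc_eq)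
  let ?g = "gain I e k" and ?w = "\<lambda>i. if i \<in> Z then 0 else int n"
  note g_def = gain_def and s_def = slack_def
  \<comment> \<open>A nonempty level set is the prefix ending at its element of largest key, so
    \<open>ok\<close> applies to it.\<close>
  have initial: "0 \<le> sum ?g {i\<in>I. z i \<le> s}" for s
  proof (cases "{i\<in>I. z i \<le> s} = {}")
    case False
    have "Max (k ` {i\<in>I. z i \<le> s}) \<in> k ` {i\<in>I. z i \<le> s}"
      by (rule Max_in) (use finI False in auto)
    then obtain i where "i \<in> I" "z i \<le> s" and max: "k i = Max (k ` {i\<in>I. z i \<le> s})" by auto
    moreover have "k j \<le> k i" if "j \<in> I" "z j \<le> s" for j
      unfolding max by (rule Max_ge) (use that finI in auto)
    ultimately obtain i where i: "i \<in> I" "z i \<le> s" "\<And>j. j \<in> I \<Longrightarrow> z j \<le> s \<Longrightarrow> k j \<le> k i"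
      by blast
    have "{i\<in>I. z i \<le> s} = {j\<in>I. k j < k i + 1}"
      using i mono_k[of _ i] by (fastforce simp: less_Suc_eq_le)
    then have "2 \<le> slack e {i\<in>I. z i \<le> s}"
      using ok[OF i(1)] by (simp add: s_def)
    moreover have "sum ?g {i\<in>I. z i \<le> s} = slack e {i\<in>I. z i \<le> s} - 2"
      by (rule sum_gain_initial[OF finI inj e]) (use mono_k in \<open>auto intro: order_trans less_imp_le\<close>)
    ultimately show ?thesis by simp
  next
    case True
    then show ?thesis by (simp only: sum.empty)
  qed
  \<comment> \<open>Summing over the level sets of \<open>z\<close>, which are prefixes, replaces Abel summation.\<close>
  have "(\<Sum>i\<in>I. ?g i * (int n - int (z i))) = (\<Sum>i\<in>I. \<Sum>s<n. ?g i * of_bool (z i \<le> s))"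
  proof (rule sum.cong[OF refl])
    fix i assume "i \<in> I"
    have "{..<n} \<inter> {s. z i \<le> s} = {z i..<n}" by auto
    then show "?g i * (int n - int (z i)) = (\<Sum>s<n. ?g i * of_bool (z i \<le> s))"
      using zn[OF \<open>i \<in> I\<close>] by (simp flip: sum_distrib_left )
  qed
  also have "\<dots> = (\<Sum>s<n. \<Sum>i\<in>I. ?g i * of_bool (z i \<le> s))" by (rule sum.swap)
  also have "\<dots> = (\<Sum>s<n. sum ?g {i\<in>I. z i \<le> s})"
    using finI by (simp add: sum.inter_filter of_bool_def if_distrib cong: if_cong)
  also have "\<dots> \<ge> 0" by (intro sum_nonneg initial)
  finally have 1: "0 \<le> (\<Sum>i\<in>I. ?g i * (int n - int (z i)))" .
  have "sum ?g Z \<le> - 1"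
    using sum_gain_le[OF finI inj e Z(1)] Z(2) by (simp add: s_def)
  then have "int n * sum ?g Z \<le> - int n" using mult_left_mono[of "sum ?g Z" "-1" "int n"] by simp
  moreover have "(\<Sum>i\<in>I. ?g i * (?w i - int (z i))) =
      (\<Sum>i\<in>I. ?g i * (int n - int (z i)) - (if i \<in> Z then int n * ?g i else 0))"
    by (intro sum.cong) (auto simp: algebra_simps)
  moreover have "(\<Sum>i\<in>I. if i \<in> Z then int n * ?g i else 0) = int n * sum ?g Z"
    using Z(1) finI by (simp add: sum.If_cases sum_distrib_left Int_absorb1)
  ultimately have 2: "int n \<le> (\<Sum>i\<in>I. ?g i * (?w i - int (z i)))"
    using 1 by (simp add: sum_subtractf)
  have "D z' \<le> (\<Sum>i\<in>I. (int (z i) - ?w i)\<^sup>2 - 2 * (?g i * (?w i - int (z i))) + 1)"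
    unfolding D_def
  proof (rule sum_mono)
    fix i assume i: "i \<in> I"
    let ?a = "r (insert e (insert i (below I k i)))" and ?b = "r (insert e (below I k i))"
    have z'i: "z' i = min n (z i + 2 * ?a - Suc (2 * ?b))"
      using z'[OF i] pre[OF i] by (simp add: below_def)
    have g: "?g i = 2 * int ?a - 2 * int ?b - 1" by (simp add: g_def)
    have gc: "?g i = 1 \<or> ?g i = - 1" by (rule gain_cases)
    \<comment> \<open>Truncated subtraction supplies the lower clip at \<open>0\<close>. Clipping to
      \<open>{0..n}\<close> does not increase the distance to a target that is \<open>0\<close> or
      \<open>n\<close>.\<close>
    have "int (z' i) = max 0 (min (int n) (int (z i) + ?g i))"
      using z'i g by linarith
    then have "\<bar>int (z' i) - ?w i\<bar> \<le> \<bar>int (z i) + ?g i - ?w i\<bar>"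
      by (cases "i \<in> Z") auto
    then have "(int (z' i) - ?w i)\<^sup>2 \<le> (int (z i) + ?g i - ?w i)\<^sup>2"
      by (simp only: abs_le_square_iff)
    also have "\<dots> = (int (z i) - ?w i)\<^sup>2 - 2 * (?g i * (?w i - int (z i))) + (?g i)\<^sup>2"
      by (simp add: power2_eq_square algebra_simps)
    also have "(?g i)\<^sup>2 = 1" using gc by auto
    finally show "(int (z' i) - ?w i)\<^sup>2
      \<le> (int (z i) - ?w i)\<^sup>2 - 2 * (?g i * (?w i - int (z i))) + 1" .
  qed
  also have "\<dots> = D z - 2 * (\<Sum>i\<in>I. ?g i * (?w i - int (z i))) + int (card I)"
    by (simp add: D_def sum.distrib sum_subtractf sum_distrib_left)
  also have "\<dots> \<le> D z - 2 * int n + int n"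
    using 2 card_mono[OF _ I] by simp
  finally show ?thesis by simp
qed

lemma descent:
  fixes I Z :: "nat set" and e n :: nat and z :: "nat \<Rightarrow> nat \<Rightarrow> nat"
  defines "k \<equiv> \<lambda>t j. z t j * n + j"
  assumes I: "I \<subseteq> {..<n}" and e: "r {e} = 1" and Z: "Z \<subseteq> I"
    and z0: "\<And>i. i \<in> I \<Longrightarrow> z 0 i = 0"
    and ok: "\<And>t i. t \<le> n\<^sup>2 \<Longrightarrow> i \<in> I \<Longrightarrow>
      card {j\<in>I. k t j < k t i + 1} + 2 \<le> 2 * r (insert e {j\<in>I. k t j < k t i + 1})"
    and zSuc: "\<And>t i. i \<in> I \<Longrightarrow> z (Suc t) i =
      min n (z t i + 2 * r (insert e {j\<in>I. k t j < k t i + 1})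
        - Suc (2 * r (insert e {j\<in>I. k t j < k t i})))"
  shows "card Z + 2 \<le> 2 * r (insert e Z)"
proof (rule ccontr)
  assume "\<not> ?thesis"
  then have Z2: "2 * r (insert e Z) < card Z + 2" by simp
  define D where "D = (\<lambda>y. \<Sum>i\<in>I. (int (y i) - (if i \<in> Z then 0 else int n))\<^sup>2)"
  have zn: "z t i \<le> n" if "i \<in> I" for t i
    using z0[OF that] zSuc[OF that] by (cases t) auto
  have "D (z t) \<le> int n ^ 3 - int t * int n" if "t \<le> Suc (n\<^sup>2)" for t
    using that
  proof (induction t)
    case 0
    have "D (z 0) \<le> (\<Sum>i\<in>I. int n ^ 2)"
      unfolding D_def by (intro sum_mono) (simp add: z0)
    also have "\<dots> \<le> int n * int n ^ 2"
      using card_mono[OF _ I] by (simp add: mult_right_mono)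
    finally show ?case by (simp add: power2_eq_square power3_eq_cube)
  next
    case (Suc t)
    have "D (z (Suc t)) \<le> D (z t) - int n"
      unfolding D_def
      by (rule descent_step[OF I e Z Z2]) (use zn ok zSuc Suc.prems in \<open>auto simp: k_def\<close>)
    with Suc show ?case by (simp add: algebra_simps)
  qed
  from this[of "Suc (n\<^sup>2)"] have "D (z (Suc (n\<^sup>2))) \<le> - int n"
    by (simp add: algebra_simps power2_eq_square power3_eq_cube)
  moreover have "0 \<le> D (z (Suc (n\<^sup>2)))" unfolding D_def by (intro sum_nonneg) simp
  \<comment> \<open>Nonnegativity leaves only \<open>n = 0\<close>, where \<open>Z\<close> is empty
    and \<open>r {e} = 1\<close> refutes the violation.\<close>
  ultimately have "I = {}" using I by auto
  with Z Z2 e show False by simp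
qed

end

section \<open>Correctness and query bound\<close>

lemma digit_2: "digit 2 c i = of_bool (i \<in> set_decode c)"
  by (simp add: digit_def set_decode_def odd_iff_mod_2_eq_one)

text \<open>Digits below the base cause no carry, so division by \<open>b\<close> strips the lowest
  one.\<close>

lemma digit_sum:
  assumes "i < n" "\<And>i. i < n \<Longrightarrow> f i < b"
  shows "digit b (\<Sum>i<n. f i * b ^ i) i = f i"
  using assms
proof (induction i arbitrary: n f)
  case (0 n f)
  then obtain m where m: "n = Suc m" by (cases n) auto
  have "(\<Sum>i<n. f i * b ^ i) = f 0 + b * (\<Sum>i<m. f (Suc i) * b ^ i)"
    by (simp add: m sum.lessThan_Suc_shift sum_distrib_left mult_ac del: sum.lessThan_Suc)
  with 0 show ?case by (simp add: digit_def)
next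
  case (Suc i n f)
  then obtain m where m: "n = Suc m" by (cases n) auto
  have "(\<Sum>i<n. f i * b ^ i) = f 0 + b * (\<Sum>i<m. f (Suc i) * b ^ i)"
    by (simp add: m sum.lessThan_Suc_shift sum_distrib_left mult_ac del: sum.lessThan_Suc)
  moreover have "f 0 < b" using Suc.prems by auto
  ultimately have "(\<Sum>i<n. f i * b ^ i) div b = (\<Sum>i<m. f (Suc i) * b ^ i)" by simp
  then show ?case
    using Suc.IH[of m "\<lambda>i. f (Suc i)"] Suc.prems m by (simp add: digit_def div_mult2_eq)
qed

lemma sum_of_bool_power_2:
  "(\<Sum>j<n. of_bool (P j) * 2 ^ j :: nat) = set_encode {j. j < n \<and> P j}"
proof -
  have "(\<Sum>j<n. of_bool (P j) * 2 ^ j :: nat) = (\<Sum>j<n. if P j then 2 ^ j else 0)"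
    by (rule sum.cong) auto
  also have "\<dots> = sum ((^) 2) {j \<in> {..<n}. P j}" by (simp only: sum.inter_filter finite_lessThan)
  finally show ?thesis by (simp add: set_encode_def)
qed

lemma partition_on_image:
  assumes P: "partition_on A P" and f: "inj_on f A"
  shows "partition_on (f ` A) ((`) f ` P)"
    and "(\<Sum>X\<in>(`) f ` P. h X) = (\<Sum>X\<in>P. h (f ` X))"
proof -
  have "(`) f ` P - {{}} = (`) f ` P" using partition_onD3[OF P] by auto
  with partition_on_inj_image[OF P f] show "partition_on (f ` A) ((`) f ` P)" by simp
  have "inj_on ((`) f) P"
    using inj_on_image_Pow[OF f] by (rule inj_on_subset) (use partition_onD1[OF P] in auto)
  then show "(\<Sum>X\<in>(`) f ` P. h X) = (\<Sum>X\<in>P. h (f ` X))" by (simp add: sum.reindex)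
qed

section \<open>Correctness for sets of natural numbers\<close>

context nat_rank_function
begin

context
  fixes n :: nat and orc :: "nat \<Rightarrow> nat"
  assumes singleton: "\<And>x. x < n \<Longrightarrow> r {x} = 1"
    and orc: "\<And>c. orc c = r (set_decode c)"
begin

context
  fixes c e :: nat
  assumes c: "set_decode c \<subseteq> {..<e}" and e: "e < n"
begin

definition "prefix z i d = {j \<in> set_decode c. key n z j < key n z i + d}"

lemma prefix_conv: "prefix z i d = {j. j < n \<and> j \<in> set_decode c \<and> key n z j < key n z i + d}"
  using c e by (auto simp: prefix_def)

lemma prefix_rank_eq: "prefix_rank orc n c e z i d = r (insert e (prefix z i d))"
proof -
  have "(\<Sum>j<n. precedes n c z i d j * 2 ^ j) = set_encode (prefix z i d)"
    by (simp only: precedes_def digit_2 of_bool_conj [symmetric] sum_of_bool_power_2 prefix_conv)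
  moreover have "finite (prefix z i d)" "e \<notin> prefix z i d"
    using c by (auto simp: prefix_def)
  ultimately show ?thesis
    unfolding prefix_rank_def orc by (simp flip: set_encode_insert)
qed

lemma sum_precedes: "(\<Sum>j<n. precedes n c z i d j) = card (prefix z i d)"
proof -
  have "prefix z i d = {..<n} \<inter> {j. j \<in> set_decode c \<and> key n z j < key n z i + d}"
    using prefix_conv by auto
  then show ?thesis by (simp add: precedes_def digit_2 flip: of_bool_conj)
qed

text \<open>Prefixes are subsets, so a valid bound leaves nothing to count. Conversely, if all
  rounds pass, \<open>descent\<close> applied to the digits of the iterates excludes every violating
  subset.\<close>

lemma violations_eq_0_iff:
  "violations orc n c e = 0 \<longleftrightarrow> (\<forall>X\<subseteq>set_decode c. card X + 2 \<le> 2 * r (insert e X))"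
proof
  assume *: "\<forall>X\<subseteq>set_decode c. card X + 2 \<le> 2 * r (insert e X)"
  have "card (prefix z i 1) + 2 \<le> 2 * r (insert e (prefix z i 1))" for z i
    using * by (auto simp: prefix_def)
  then have "violated orc n c e z i = 0" for z i
    by (simp add: violated_def prefix_rank_eq sum_precedes not_less)
  then show "violations orc n c e = 0" by (simp add: violations_def)
next
  assume 0: "violations orc n c e = 0"
  define y where "y = (\<lambda>t. (update orc n c e ^^ t) 0)"
  have ok: "card (prefix (y t) i 1) + 2 \<le> 2 * r (insert e (prefix (y t) i 1))"
    if "t \<le> n\<^sup>2" "i \<in> set_decode c" for t i
  proof -
    have "i < n" using that c e by auto
    with 0 that have "violated orc n c e (y t) i = 0"
      by (auto simp: violations_def y_def simp del: sum.lessThan_Suc)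
    with that show ?thesis
      by (simp add: violated_def prefix_rank_eq sum_precedes digit_2)
  qed
  \<comment> \<open>Clipping at \<open>n\<close> keeps each new digit below the base
    \<open>Suc n\<close>, so the code is read back faithfully.\<close>
  have digits: "digit (Suc n) (y (Suc t)) i = new_digit orc n c e (y t) i"
    if "i \<in> set_decode c" for t i
    using digit_sum[of i n "new_digit orc n c e (y t)" "Suc n"] that c e
    by (auto simp: y_def update_def new_digit_def)
  show "\<forall>X\<subseteq>set_decode c. card X + 2 \<le> 2 * r (insert e X)"
  proof (intro allI impI)
    fix X assume X: "X \<subseteq> set_decode c"
    show "card X + 2 \<le> 2 * r (insert e X)"
    proof (rule descent[where I = "set_decode c" and n = n and
          z = "\<lambda>t. digit (Suc n) (y t)"])
      show "set_decode c \<subseteq> {..<n}" using c e by auto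
      show "r {e} = 1" by (rule singleton[OF e])
      show "X \<subseteq> set_decode c" by (rule X)
      show "digit (Suc n) (y 0) i = 0" for i by (simp add: y_def digit_def)
    qed (use ok digits in \<open>simp_all add: new_digit_def prefix_rank_eq prefix_def key_def\<close>)
  qed
qed

end

lemma greedy_properties:
  fixes c e :: nat
  assumes "e \<le> n"
  defines "I \<equiv> \<lambda>e. set_decode (greedy orc n c e)"
  shows "I e \<subseteq> set_decode c \<inter> {..<e} \<and> sparse (I e) \<and>
    (\<forall>x\<in>set_decode c \<inter> {..<e} - I e. \<exists>X\<subseteq>I e. 2 * r (insert x X) < card X + 2)"
  using assms(1)
proof (induction e)
  case 0
  then show ?case by (simp add: I_def sparse_def)
next
  case (Suc e)
  then have IH: "I e \<subseteq> set_decode c" "I e \<subseteq> {..<e}" "sparse (I e)"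
    "\<And>x. x \<in> set_decode c \<Longrightarrow> x < e \<Longrightarrow> x \<notin> I e \<Longrightarrow> \<exists>X\<subseteq>I e. 2 * r (insert x X) < card X + 2"
    by auto
  have iff: "violations orc n (greedy orc n c e) e = 0 \<longleftrightarrow>
      (\<forall>X\<subseteq>I e. card X + 2 \<le> 2 * r (insert e X))"
    unfolding I_def by (rule violations_eq_0_iff) (use IH Suc.prems in \<open>auto simp: I_def\<close>)
  have "e \<notin> I e" using IH by auto
  then have plus: "set_decode (greedy orc n c e + 2 ^ e) = insert e (I e)"
    unfolding I_def by (subst add.commute) (rule set_decode_plus_power_2)
  show ?case
  proof (cases "e \<in> set_decode c \<and> violations orc n (greedy orc n c e) e = 0")
    case True
    then have I: "I (Suc e) = insert e (I e)" using plus by (simp add: I_def digit_2)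
    have "sparse (insert e (I e))"
      by (rule sparse_insert) (use IH True iff in \<open>auto simp: I_def\<close>)
    \<comment> \<open>A set that witnessed an earlier rejection remains available, since the greedy
      set only grows.\<close>
    moreover have "\<exists>X\<subseteq>insert e (I e). 2 * r (insert x X) < card X + 2"
      if "x \<in> set_decode c" "x < Suc e" "x \<notin> insert e (I e)" for x
      using IH(4)[of x] that by (auto simp: less_Suc_eq intro: subset_insertI2)
    ultimately show ?thesis using IH True unfolding I by auto
  next
    case False
    then have I: "I (Suc e) = I e" by (auto simp: I_def digit_2)
    have "\<exists>X\<subseteq>I e. 2 * r (insert x X) < card X + 2"
      if x: "x \<in> set_decode c" "x < Suc e" "x \<notin> I e" for x
    proof (cases "x = e")
      case True
      with False x iff show ?thesis by (auto simp: not_le)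
    next
      case False
      with IH(4)[of x] x show ?thesis by auto
    qed
    then show ?thesis using IH unfolding I by auto
  qed
qed

text \<open>The cardinality of the greedy set is a lower bound for every partition sum and is
  attained. The two halves are kept apart so that they can be transported along the
  numbering.\<close>

lemma val_Main_alg:
  assumes "set_decode c \<subseteq> {..<n}"
  shows "(\<forall>P. partition_on (set_decode c) P \<longrightarrow>
      int (val orc Main_alg [n, c]) \<le> (\<Sum>X\<in>P. 2 * int (r X) - 1)) \<and>
    (\<exists>P. partition_on (set_decode c) P \<and>
      (\<Sum>X\<in>P. 2 * int (r X) - 1) = int (val orc Main_alg [n, c]))"
proof -
  define I where "I = set_decode (greedy orc n c n)"
  have I: "I \<subseteq> set_decode c" "sparse I"
    "\<And>x. x \<in> set_decode c - I \<Longrightarrow> \<exists>X\<subseteq>I. 2 * r (insert x X) < card X + 2"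
    using greedy_properties[of n c] assms unfolding I_def by auto
  have "{..<n} \<inter> I = I" using I assms by auto
  then have v: "val orc Main_alg [n, c] = card I"
    by (simp add: Main_alg digit_2 I_def)
  have s: "r {x} = 1" if "x \<in> set_decode c" for x
    using that assms singleton by auto
  show ?thesis
    unfolding v
    using card_le_partition_sum[OF finite_set_decode I(1,2) s]
      ex_partition_sum_eq_card[OF finite_set_decode I(1,2) s I(3)] by blast
qed

end

end

section \<open>Transfer to the matroid along the numbering\<close>

lemma (in matroid) rank_function_vimage:
  assumes "inj_on idx E"
  shows "rank_function (\<lambda>T. rank indep {e \<in> E. idx e \<in> T})"
proof
  \<comment> \<open>The element \<open>a\<close> is chosen before \<open>T\<close>, because
    diminishing returns needs the same one for \<open>A\<close> and \<open>B\<close>.\<close>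
  have *: "{e \<in> E. idx e \<in> insert x T} = {e \<in> E. idx e \<in> T} \<and> x \<notin> idx ` E \<or>
    (\<exists>a. \<forall>T. {e \<in> E. idx e \<in> insert x T} = insert a {e \<in> E. idx e \<in> T})" for x T
  proof (cases "x \<in> idx ` E")
    case True
    then obtain a where "a \<in> E" "x = idx a" by auto
    then have "{e \<in> E. idx e \<in> insert x T} = insert a {e \<in> E. idx e \<in> T}" for T
      using inj_onD[OF assms] by auto
    then show ?thesis by blast
  qed auto
  fix A B x
  show "rank indep {e \<in> E. idx e \<in> {}} = 0"
    using rank_attained[of "{}"] by auto
  show "rank indep {e \<in> E. idx e \<in> A} \<le> rank indep {e \<in> E. idx e \<in> B}" if "A \<subseteq> B"
    by (rule rank_mono) (use that in auto)
  show "rank indep {e \<in> E. idx e \<in> insert x A} \<le> Suc (rank indep {e \<in> E. idx e \<in> A})"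
    using *[of x A] rank_insert_le by (elim disjE exE conjE) simp_all
  show "rank indep {e \<in> E. idx e \<in> insert x B} + rank indep {e \<in> E. idx e \<in> A}
    \<le> rank indep {e \<in> E. idx e \<in> insert x A} + rank indep {e \<in> E. idx e \<in> B}" if "A \<subseteq> B"
    using *[of x B]
  proof (elim disjE exE conjE)
    fix a assume "\<forall>T. {e \<in> E. idx e \<in> insert x T} = insert a {e \<in> E. idx e \<in> T}"
    then show ?thesis
      using that by (simp only:) (rule rank_diminishing_returns, auto)
  next
    assume "{e \<in> E. idx e \<in> insert x B} = {e \<in> E. idx e \<in> B}"
    moreover have "rank indep {e \<in> E. idx e \<in> A} \<le> rank indep {e \<in> E. idx e \<in> insert x A}"
      by (rule rank_mono) auto
    ultimately show ?thesis by simp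
  qed
qed

lemma (in loopless_matroid) val_Main_alg_rank_oracle:
  assumes idx: "bij_betw idx E {..<card E}" and S: "S \<subseteq> E"
  shows "int (val (rank_oracle E indep idx) Main_alg [card E, encode_subset idx S])
    = partition_rank indep S"
proof -
  let ?r = "\<lambda>T. rank indep {e \<in> E. idx e \<in> T}"
  let ?v = "val (rank_oracle E indep idx) Main_alg [card E, encode_subset idx S]"
  have inj: "inj_on idx E" using idx by (rule bij_betw_imp_inj_on)
  interpret nat_rank_function ?r
    unfolding nat_rank_function_def by (rule rank_function_vimage[OF inj])
  have finS: "finite S" using S finite_ground finite_subset by blast
  then have dec: "set_decode (encode_subset idx S) = idx ` S"
    by (simp add: encode_subset_def)
  have singleton: "?r {x} = 1" if "x < card E" for x
  proof -
    have "x \<in> idx ` E" using that bij_betw_imp_surj_on[OF idx] by simp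
    then obtain a where a: "a \<in> E" "x = idx a" by auto
    then have eq: "{e \<in> E. idx e \<in> {x}} = {a}" using inj_onD[OF inj] by auto
    have "card {a} \<le> rank indep {a}" using loopless[OF a(1)] by (intro card_le_rank) auto
    moreover have "rank indep {a} \<le> Suc (rank indep {})" using rank_insert_le[of a "{}"] .
    moreover have "rank indep {} = 0" using rank_attained[of "{}"] by auto
    ultimately show ?thesis unfolding eq by simp
  qed
  have "idx ` S \<subseteq> {..<card E}" using S bij_betw_imp_surj_on[OF idx] by auto
  then have main: "(\<forall>P. partition_on (idx ` S) P \<longrightarrow> int ?v \<le> (\<Sum>X\<in>P. 2 * int (?r X) - 1))"
    "(\<exists>P. partition_on (idx ` S) P \<and> (\<Sum>X\<in>P. 2 * int (?r X) - 1) = int ?v)"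
    using val_Main_alg[of "card E" "rank_oracle E indep idx" "encode_subset idx S"] singleton
    by (auto simp: dec rank_oracle_def)
  have r_image: "?r (idx ` X) = rank indep X" if "X \<subseteq> E" for X
  proof -
    have "{e \<in> E. idx e \<in> idx ` X} = X" using that inj_on_image_mem_iff[OF inj] by auto
    then show ?thesis by simp
  qed
  have injS: "inj_on idx S" using inj S by (rule inj_on_subset)
  have sum_image: "(\<Sum>X\<in>(`) idx ` P. 2 * int (?r X) - 1) = (\<Sum>X\<in>P. 2 * int (rank indep X) - 1)"
    if "partition_on S P" for P
  proof -
    have "X \<subseteq> E" if "X \<in> P" for X using partition_onD1[OF \<open>partition_on S P\<close>] that S by auto
    then show ?thesis
      unfolding partition_on_image(2)[OF that injS] by (intro sum.cong) (simp_all add: r_image)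
  qed
  show ?thesis
    unfolding partition_rank_def
  proof (rule Min_eqI[symmetric])
    show "finite ((\<lambda>P. \<Sum>X\<in>P. 2 * int (rank indep X) - 1) ` {P. partition_on S P})"
      using finitely_many_partition_on[OF finS] by simp
    show "int ?v \<le> y"
      if "y \<in> (\<lambda>P. \<Sum>X\<in>P. 2 * int (rank indep X) - 1) ` {P. partition_on S P}" for y
      using that main(1) partition_on_image(1)[OF _ injS] sum_image by fastforce
    obtain Q where Q: "partition_on (idx ` S) Q" "(\<Sum>X\<in>Q. 2 * int (?r X) - 1) = int ?v"
      using main(2) by blast
    \<comment> \<open>An optimal partition of the numbers is pulled back to \<open>S\<close>;
      mapping it forward again recovers \<open>Q\<close> and hence its sum.\<close>
    let ?g = "inv_into S idx"
    have "partition_on (?g ` idx ` S) ((`) ?g ` Q)"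
      by (rule partition_on_image(1)[OF Q(1)]) (rule inj_on_inv_into, simp)
    then have P: "partition_on S ((`) ?g ` Q)"
      by (simp add: inv_into_image_cancel[OF injS])
    have "idx ` ?g ` Y = Y" if "Y \<in> Q" for Y
      using partition_onD1[OF Q(1)] that by (intro image_inv_into_cancel) auto
    then have "(`) idx ` (`) ?g ` Q = Q" by (simp add: image_image)
    with sum_image[OF P] Q(2) P
    show "int ?v \<in> (\<lambda>P. \<Sum>X\<in>P. 2 * int (rank indep X) - 1) ` {P. partition_on S P}"
      by (intro image_eqI[of _ _ "(`) ?g ` Q"]) simp_all
  qed
qed

theorem theorem1p5:
  "\<exists>(A :: alg) (p :: nat poly).
     \<forall>(E :: 'a set) indep idx S.
       loopless_matroid E indep \<longrightarrow> bij_betw idx E {..<card E} \<longrightarrow> S \<subseteq> E \<longrightarrow>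
       (\<exists>v q. eval (rank_oracle E indep idx) A [card E, encode_subset idx S] v q \<and>
              int v = partition_rank indep S \<and> q \<le> poly p (card E))"
proof (intro exI allI impI conjI)
  fix E :: "'a set" and indep idx S
  assume "loopless_matroid E indep" and idx: "bij_betw idx E {..<card E}" "S \<subseteq> E"
  then interpret loopless_matroid E indep by simp
  let ?orc = "rank_oracle E indep idx" and ?xs = "[card E, encode_subset idx S]"
  show "eval ?orc Main_alg ?xs (val ?orc Main_alg ?xs) (cost ?orc Main_alg ?xs)"
    by (rule eval_val) (simp add: Main_alg(1)[unfolded numeral_2_eq_2])
  show "int (val ?orc Main_alg ?xs) = partition_rank indep S"
    by (rule val_Main_alg_rank_oracle[OF idx])
  let ?n = "card E"
  \<comment> \<open>Bounding \<open>t\<close> by the square of \<open>?n\<close> gives a product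
    that is visibly polynomial; \<open>monom 1 1\<close> is the variable of the witness.\<close>
  have "(\<Sum>t<Suc (?n\<^sup>2). t * (2 * ?n) + ?n) \<le> (\<Sum>t<Suc (?n\<^sup>2). ?n\<^sup>2 * (2 * ?n) + ?n)"
    by (intro sum_mono) auto
  then have "cost ?orc Main_alg ?xs \<le> ?n * (Suc (?n\<^sup>2) * (?n\<^sup>2 * (2 * ?n) + ?n))"
    unfolding Main_alg(3) by (intro mult_left_mono) simp_all
  then show "cost ?orc Main_alg ?xs
      \<le> poly (monom 1 1 * ((1 + (monom 1 1)\<^sup>2) * ((monom 1 1)\<^sup>2 * (2 * monom 1 1) + monom 1 1))) ?n"
    by (simp add: poly_monom)
qed

end
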